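(* Let $\Sigma^1_t$ and $\Sigma^2_t$ be two hypersurfaces in $\mathbb{H}^n$ evolved by mean curvature flow for $t\in[0,T)$, and assume that $\Sigma^1_0$ is compact. Let $$d(t)=\inf_{p\in\Sigma^1_t,\ q\in\Sigma^2_t}d(p,q),$$ where $d(p,q)$ is the distance function of $\mathbb{H}^n$. Then for any $t\in[0,T)$, $$e^t\sinh\frac{d(t)}{2}\ \ge\ \sinh\frac{d(0)}{2}.$$ In particular, $e^t d(t)\ge d(0)$.
   Context: $\mathbb{H}^n$ is hyperbolic $n$-space of constant sectional curvature $-1$. A hypersurface $\Sigma_t=F(N,t)$, with $N$ a smooth $(n-1)$-dimensional manifold without boundary, evolves by mean curvature flow (MCF) if $F:N\times[0,T)\to\mathbb{H}^n$ satisfies $\partial_tF=-H\nu$, starting from a smooth embedding $F(\cdot,0)$, where $H$ is the mean curvature with respect to the outer unit normal $\nu$. Normalization: $H$ is the average $\frac{1}{n-1}(k_1+\dots+k_{n-1})$ of the principal curvatures, with sign such that geodesic spheres have $H>0$ (so a geodesic sphere of radius $r$ evolves by $\frac{dr}{dt}=-\coth r$).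
   Formalization: The second flow is additionally assumed proper on compact time intervals (automatic if compact); without this the claim fails, e.g. for a short open arc of a small shrinking circle in the hyperbolic plane next to a larger shrinking circle. Both hypersurfaces are nonempty. *)

theory Defs
  imports "HOL-Analysis.Analysis"
begin

section \<open>Hyperbolic space: the hyperboloid model\<close>

text \<open>
  For a Euclidean space \<open>'a\<close> of dimension \<open>n\<close>, the space \<open>'a \<times> real\<close> with the Lorentzian form
  \<open>minkowski\<close> is Minkowski space \<open>\<real>\<^bsup>n,1\<^esup>\<close>. The form is positive definite on the tangent spaces
  of \<open>hyperbolic_space\<close>, and induces there the metric of constant sectional curvature \<open>-1\<close>.
\<close>

definition minkowski :: "'a::euclidean_space \<times> real \<Rightarrow> 'a \<times> real \<Rightarrow> real" where
  "minkowski p q = fst p \<bullet> fst q - snd p * snd q"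

definition hyperbolic_space :: "('a::euclidean_space \<times> real) set" where
  "hyperbolic_space = {p. minkowski p p = - 1 \<and> snd p > 0}"

definition hyperbolic_dist :: "'a::euclidean_space \<times> real \<Rightarrow> 'a \<times> real \<Rightarrow> real" where
  "hyperbolic_dist p q = arcosh (- minkowski p q)"

definition hyperbolic_setdist :: "('a::euclidean_space \<times> real) set \<Rightarrow> ('a \<times> real) set \<Rightarrow> real" where
  "hyperbolic_setdist A B = (INF (p, q) \<in> A \<times> B. hyperbolic_dist p q)"


section \<open>Smooth maps and smooth manifolds\<close>

text \<open>
  The derivatives are taken within \<open>S\<close>. They are used for \<open>S = U \<times> [0,T)\<close> with \<open>U\<close> open; there
  they are unique, and at time \<open>0\<close> the time derivatives are one-sided.
\<close>

primrec Ck_on :: "nat \<Rightarrow> 'a set \<Rightarrow> ('a::euclidean_space \<Rightarrow> 'b::real_normed_vector) \<Rightarrow> bool" where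
  "Ck_on 0 S f \<longleftrightarrow> continuous_on S f"
| "Ck_on (Suc k) S f \<longleftrightarrow>
     (\<exists>f'. (\<forall>x\<in>S. (f has_derivative f' x) (at x within S)) \<and> (\<forall>v. Ck_on k S (\<lambda>x. f' x v)))"

definition smooth_on :: "'a set \<Rightarrow> ('a::euclidean_space \<Rightarrow> 'b::real_normed_vector) \<Rightarrow> bool" where
  "smooth_on S f \<longleftrightarrow> (\<forall>k. Ck_on k S f)"

text \<open>
  A smooth manifold without boundary, of dimension \<open>DIM('m)\<close>: every chart maps onto an open subset
  of \<open>'m\<close>. The atlas need not be maximal.
\<close>

definition smooth_manifold ::
  "'p topology \<Rightarrow> ('p set \<times> ('p \<Rightarrow> 'm::euclidean_space)) set \<Rightarrow> bool" where
  "smooth_manifold N \<A> \<longleftrightarrow>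
     Hausdorff_space N \<and> second_countable N \<and>
     (\<Union>(U, \<phi>)\<in>\<A>. U) = topspace N \<and>
     (\<forall>(U, \<phi>)\<in>\<A>. openin N U \<and> open (\<phi> ` U) \<and>
        homeomorphic_map (subtopology N U) (top_of_set (\<phi> ` U)) \<phi>) \<and>
     (\<forall>(U, \<phi>)\<in>\<A>. \<forall>(V, \<psi>)\<in>\<A>. smooth_on (\<phi> ` (U \<inter> V)) (\<psi> \<circ> inv_into U \<phi>))"


section \<open>Mean curvature of a parametrised hypersurface\<close>

text \<open>
  Here \<open>G\<close> is a local parametrisation of a hypersurface of \<open>hyperbolic_space\<close>, \<open>x\<close> a parameter and
  \<open>\<nu>\<close> a vector at \<open>G x\<close>. The tangent space of \<open>hyperbolic_space\<close> at a point is the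
  \<open>minkowski\<close>-orthogonal complement of this point.
\<close>

definition unit_normal ::
  "('m::euclidean_space \<Rightarrow> 'a::euclidean_space \<times> real) \<Rightarrow> 'm \<Rightarrow> 'a \<times> real \<Rightarrow> bool" where
  "unit_normal G x \<nu> \<longleftrightarrow>
     minkowski \<nu> (G x) = 0 \<and> minkowski \<nu> \<nu> = 1 \<and>
     (\<forall>v. minkowski \<nu> (frechet_derivative G (at x) v) = 0)"

definition first_fundamental_form ::
  "('m::euclidean_space \<Rightarrow> 'a::euclidean_space \<times> real) \<Rightarrow> 'm \<Rightarrow> 'm \<Rightarrow> 'm \<Rightarrow> real" where
  "first_fundamental_form G x v w =
     minkowski (frechet_derivative G (at x) v) (frechet_derivative G (at x) w)"

text \<open>
  The Levi-Civita connection of \<open>hyperbolic_space\<close> is the tangential part of the flat connection, and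
  the part removed is a multiple of the position vector, hence orthogonal to \<open>\<nu>\<close>; so the flat second
  derivative suffices. The sign is such that geodesic spheres have positive principal curvatures
  (\<open>coth r\<close>) with respect to the outer normal.
\<close>

definition second_fundamental_form ::
  "('m::euclidean_space \<Rightarrow> 'a::euclidean_space \<times> real) \<Rightarrow> 'm \<Rightarrow> 'a \<times> real \<Rightarrow> 'm \<Rightarrow> 'm \<Rightarrow> real" where
  "second_fundamental_form G x \<nu> v w =
     - minkowski (frechet_derivative (\<lambda>y. frechet_derivative G (at y) v) (at x) w) \<nu>"

text \<open>
  The vectors \<open>e i\<close> are principal directions, orthonormal for the first fundamental form. The basis
  of \<open>'m\<close> is only used as an index set with \<open>DIM('m) = n - 1\<close> elements.
\<close>

definition principal_curvatures ::
  "('m::euclidean_space \<Rightarrow> 'a::euclidean_space \<times> real) \<Rightarrow> 'm \<Rightarrow> 'a \<times> real \<Rightarrow> ('m \<Rightarrow> real) \<Rightarrow> bool" where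
  "principal_curvatures G x \<nu> k \<longleftrightarrow>
     (\<exists>e. \<forall>i\<in>Basis. \<forall>j\<in>Basis.
        first_fundamental_form G x (e i) (e j) = (if i = j then 1 else 0) \<and>
        second_fundamental_form G x \<nu> (e i) (e j) = (if i = j then k i else 0))"

definition mean_curvature ::
  "('m::euclidean_space \<Rightarrow> 'a::euclidean_space \<times> real) \<Rightarrow> 'm \<Rightarrow> 'a \<times> real \<Rightarrow> real \<Rightarrow> bool" where
  "mean_curvature G x \<nu> H \<longleftrightarrow>
     (\<exists>k. principal_curvatures G x \<nu> k \<and> H = (\<Sum>i\<in>Basis. k i) / real DIM('m))"


section \<open>Mean curvature flow\<close>

definition time_interval :: "ereal \<Rightarrow> real set" where
  "time_interval T = {t. 0 \<le> t \<and> ereal t < T}"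

text \<open>
  Replacing \<open>\<nu>\<close> by \<open>-\<nu>\<close> replaces \<open>H\<close> by \<open>-H\<close>, so the velocity \<open>-H\<nu>\<close> does not depend on the choice
  of the unit normal. Hence any unit normal may be used in the flow equation; in particular the outer
  one, whenever an outer side is defined.
\<close>

definition mean_curvature_flow ::
  "'p topology \<Rightarrow> ('p set \<times> ('p \<Rightarrow> 'm::euclidean_space)) set \<Rightarrow> ereal \<Rightarrow>
   ('p \<Rightarrow> real \<Rightarrow> 'a::euclidean_space \<times> real) \<Rightarrow> bool" where
  "mean_curvature_flow N \<A> T F \<longleftrightarrow>
     (\<forall>p\<in>topspace N. \<forall>t\<in>time_interval T. F p t \<in> hyperbolic_space) \<and>
     (\<forall>(U, \<phi>)\<in>\<A>. smooth_on (\<phi> ` U \<times> time_interval T) (\<lambda>(x, t). F (inv_into U \<phi> x) t)) \<and>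
     embedding_map N (top_of_set hyperbolic_space) (\<lambda>p. F p 0) \<and>
     (\<forall>(U, \<phi>)\<in>\<A>. \<forall>p\<in>U. \<forall>t\<in>time_interval T.
        let G = (\<lambda>x. F (inv_into U \<phi> x) t) in
          inj (frechet_derivative G (at (\<phi> p))) \<and>
          (\<exists>\<nu> H. unit_normal G (\<phi> p) \<nu> \<and> mean_curvature G (\<phi> p) \<nu> H \<and>
             (F p has_vector_derivative - (H *\<^sub>R \<nu>)) (at t within time_interval T)))"

text \<open>
  The hypersurfaces are properly immersed, locally uniformly in time. This holds automatically if
  \<open>N\<close> is compact. For noncompact \<open>N\<close> it makes precise that the hypersurface has no edge: otherwise
  a small open arc of a shrinking circle would count as a flow, and such arcs violate the avoidance
  principle, as their ends are not controlled.
\<close>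

definition proper_flow ::
  "'p topology \<Rightarrow> ereal \<Rightarrow> ('p \<Rightarrow> real \<Rightarrow> 'a::euclidean_space \<times> real) \<Rightarrow> bool" where
  "proper_flow N T F \<longleftrightarrow>
     (\<forall>t\<in>time_interval T.
        proper_map (prod_topology N (top_of_set {0..t})) (top_of_set hyperbolic_space)
          (\<lambda>(p, s). F p s))"

end

theory Submission
  imports Defs
begin

text \<open>
  For the flows \<open>p(t)\<close>, \<open>q(t)\<close> of two points put \<open>W = cosh d(p, q) = - minkowski p q\<close>. Since a
  hypersurface \<open>F\<close> of the hyperboloid satisfies \<open>\<Delta>F = (n - 1) (F - H \<nu>)\<close>, mean curvature flow reads
  \<open>\<partial>\<^sub>tF = \<Delta>F / (n - 1) - F\<close>. At a spatial minimum of \<open>W\<close> with \<open>W > 1\<close> the two tangent spaces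
  coincide, and moving both points in parallel gives \<open>\<partial>\<^sub>tW \<ge> - 2 (W - 1)\<close>. So the minimum of
  \<open>exp (2 t) (W - 1) = 2 (exp t sinh (d / 2))\<^sup>2\<close> does not decrease. To make this rigorous, look at the
  first time at which \<open>exp (2 t) (W - 1) + \<epsilon> t\<close> reaches a level \<open>c\<close> below its initial infimum; properness
  confines the second hypersurface to a compact set there, and \<open>c > \<epsilon> t\<close> ensures \<open>W > 1\<close>.
\<close>

section \<open>Minkowski space\<close>

lemma bounded_bilinear_minkowski: "bounded_bilinear minkowski"
proof -
  have "bounded_linear (\<lambda>q :: 'a \<times> real. (fst q, - snd q))"
    by (intro bounded_linear_Pair bounded_linear_fst bounded_linear_minus bounded_linear_snd)
  from bounded_bilinear.comp[OF bounded_bilinear_inner bounded_linear_ident this]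
  show ?thesis
    by (simp add: minkowski_def[abs_def] inner_prod_def)
qed

interpretation minkowski: bounded_bilinear minkowski
  by (rule bounded_bilinear_minkowski)

lemma minkowski_commute: "minkowski p q = minkowski q p"
  by (simp add: minkowski_def inner_commute mult.commute)

lemma hyperbolic_space_iff:
  "p \<in> hyperbolic_space \<longleftrightarrow> (norm (fst p))\<^sup>2 = (snd p)\<^sup>2 - 1 \<and> snd p > 0"
  unfolding hyperbolic_space_def minkowski_def power2_norm_eq_inner power2_eq_square[of "snd p"]
  by auto

text \<open>Reversed Cauchy-Schwarz inequality on the upper sheet; it puts
  \<open>- minkowski p q\<close> into the range where \<open>arcosh\<close> inverts
  \<open>cosh\<close>. With \<open>a\<close>, \<open>b\<close> the norms of the spatial parts, the
  squares of \<open>snd p * snd q\<close> and \<open>a * b + 1\<close> differ by the square of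
  \<open>a - b\<close>; the ordinary Cauchy-Schwarz inequality does the rest.\<close>

lemma minkowski_le_neg_1:
  assumes "p \<in> hyperbolic_space" "q \<in> hyperbolic_space"
  shows "minkowski p q \<le> - 1"
proof -
  have eqs: "(norm (fst p))\<^sup>2 = (snd p)\<^sup>2 - 1" "(norm (fst q))\<^sup>2 = (snd q)\<^sup>2 - 1"
    and pos: "snd p > 0" "snd q > 0"
    using assms by (auto simp: hyperbolic_space_iff)
  let ?a = "norm (fst p)" and ?b = "norm (fst q)"
  have "(?a * ?b + 1)\<^sup>2 + (?a - ?b)\<^sup>2 = (snd p * snd q)\<^sup>2"
  proof -
    have "(snd p)\<^sup>2 = ?a\<^sup>2 + 1" "(snd q)\<^sup>2 = ?b\<^sup>2 + 1"
      using eqs by auto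
    then show ?thesis
      unfolding power_mult_distrib power2_sum power2_diff by (simp add: algebra_simps)
  qed
  then have "(?a * ?b + 1)\<^sup>2 \<le> (snd p * snd q)\<^sup>2"
    using zero_le_power2[of "?a - ?b"] by linarith
  then have "?a * ?b + 1 \<le> snd p * snd q"
    by (rule power2_le_imp_le) (use pos in auto)
  then show ?thesis
    using norm_cauchy_schwarz[of "fst p" "fst q"] by (simp add: minkowski_def)
qed

text \<open>Coercivity in \<open>q\<close>: a bound on the distance to \<open>p\<close> bounds the
  height of \<open>q\<close>. With \<open>a\<close> the norm of \<open>fst p\<close>, the form
  \<open>- minkowski p q\<close> is at least \<open>snd q * (snd p - a)\<close>, and
  \<open>snd p - a = 1 / (snd p + a)\<close> is at least \<open>1 / (2 * snd p)\<close>.\<close>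

lemma snd_le_minkowski:
  assumes "p \<in> hyperbolic_space" "q \<in> hyperbolic_space"
  shows "snd q \<le> 2 * snd p * (- minkowski p q)"
proof -
  have eqs: "(norm (fst p))\<^sup>2 = (snd p)\<^sup>2 - 1" "(norm (fst q))\<^sup>2 = (snd q)\<^sup>2 - 1"
    and pos: "snd p > 0" "snd q > 0"
    using assms by (auto simp: hyperbolic_space_iff)
  let ?a = "norm (fst p)" and ?b = "norm (fst q)"
  have a: "?a \<le> snd p" and b: "?b \<le> snd q"
    by (rule power2_le_imp_le; use eqs pos in simp)+
  have "snd q = snd q * ((snd p + ?a) * (snd p - ?a))"
    using eqs(1) square_diff_square_factored[of "snd p" ?a] by (simp add: power2_eq_square)
  also have "\<dots> \<le> snd q * (2 * snd p * (snd p - ?a))"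
    using a pos by (intro mult_left_mono mult_right_mono) auto
  also have "\<dots> = 2 * snd p * (snd p * snd q - ?a * snd q)"
    by (simp add: algebra_simps)
  also have "\<dots> \<le> 2 * snd p * (snd p * snd q - ?a * ?b)"
    using b pos by (intro mult_left_mono diff_left_mono mult_left_mono) auto
  also have "\<dots> \<le> 2 * snd p * (- minkowski p q)"
    using norm_cauchy_schwarz[of "fst p" "fst q"] pos
    by (intro mult_left_mono) (auto simp: minkowski_def)
  finally show ?thesis .
qed

lemma compact_hyperbolic_space_bounded_height:
  "compact {q \<in> hyperbolic_space. snd q \<le> R}"
proof -
  \<comment> \<open>The condition \<open>snd q > 0\<close> is relaxed to obtain a closed set; the
    equation rules out \<open>snd q = 0\<close>, since a squared norm is never
    \<open>- 1\<close>.\<close>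
  let ?B = "{q :: 'a \<times> real. (norm (fst q))\<^sup>2 = (snd q)\<^sup>2 - 1 \<and> 0 \<le> snd q \<and> snd q \<le> R}"
  have "0 < snd q" if "(norm (fst q))\<^sup>2 = (snd q)\<^sup>2 - 1" "0 \<le> snd q" for q :: "'a \<times> real"
    using that zero_le_power2[of "norm (fst q)"] by (cases "snd q = 0") auto
  then have "{q :: 'a \<times> real. q \<in> hyperbolic_space \<and> snd q \<le> R} = ?B"
    by (auto simp: hyperbolic_space_iff)
  moreover have "closed ?B"
    by (intro closed_Collect_conj closed_Collect_eq closed_Collect_le continuous_intros)
  moreover have "?B \<subseteq> cball 0 R \<times> {0..R}"
  proof
    fix q :: "'a \<times> real" assume q: "q \<in> ?B"
    have "norm (fst q) \<le> snd q"
      by (rule power2_le_imp_le) (use q in auto)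
    with q show "q \<in> cball 0 R \<times> {0..R}"
      by (cases q) auto
  qed
  then have "bounded ?B"
    by (rule bounded_subset[rotated]) (intro bounded_Times bounded_cball bounded_closed_interval)
  ultimately show ?thesis
    by (simp add: compact_eq_bounded_closed)
qed

text \<open>Orthogonal non-null vectors are independent, so by its cardinality \<open>B\<close>
  spans the space and \<open>z\<close> is orthogonal to every vector. Testing against
  \<open>(fst z, - snd z)\<close> turns the indefinite form into the Euclidean square of
  \<open>z\<close>.\<close>

lemma minkowski_orthogonal_basis_eq_0:
  fixes B :: "('a::euclidean_space \<times> real) set"
  assumes "finite B" and card: "card B = DIM('a) + 1"
    and orth: "\<And>b c. b \<in> B \<Longrightarrow> c \<in> B \<Longrightarrow> b \<noteq> c \<Longrightarrow> minkowski b c = 0"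
    and nonnull: "\<And>b. b \<in> B \<Longrightarrow> minkowski b b \<noteq> 0"
    and z: "\<And>b. b \<in> B \<Longrightarrow> minkowski z b = 0"
  shows "z = 0"
proof -
  have "independent B"
  proof (rule independent_if_scalars_zero[OF \<open>finite B\<close>])
    fix f b assume sum: "(\<Sum>x\<in>B. f x *\<^sub>R x) = 0" and b: "b \<in> B"
    have "0 = (\<Sum>x\<in>B. f x * minkowski x b)"
      using arg_cong[OF sum, of "\<lambda>v. minkowski v b"]
      by (simp add: minkowski.sum_left minkowski.scaleR_left minkowski.zero_left)
    also have "\<dots> = (\<Sum>x\<in>B. if x = b then f b * minkowski b b else 0)"
      using orth b by (intro sum.cong) auto
    finally show "f b = 0"
      using nonnull[OF b] b \<open>finite B\<close> by simp
  qed
  then have "UNIV \<subseteq> span B"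
    using card by (intro card_ge_dim_independent) auto
  moreover have "minkowski z x = 0" if "x \<in> span B" for x
    using that
  proof (induction rule: span_induct_alt)
    case base
    show ?case by (rule minkowski.zero_right)
  next
    case (step c x y)
    then show ?case using z by (simp add: minkowski.add_right minkowski.scaleR_right)
  qed
  ultimately have "minkowski z (fst z, - snd z) = 0"
    by blast
  then show ?thesis
    by (simp add: minkowski_def flip: inner_real_def inner_prod_def)
qed

text \<open>The position \<open>p\<close>, the normal and the tangent frame \<open>E\<close> form a
  Lorentz-orthonormal basis; the minus sign in front of the \<open>p\<close> component is due to
  \<open>p\<close> being timelike. The difference of both sides is orthogonal to this basis.\<close>

lemma minkowski_orthonormal_expansion:
  fixes E :: "'m::euclidean_space \<Rightarrow> 'a::euclidean_space \<times> real"
  assumes dim: "DIM('a) = DIM('m) + 1"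
    and p: "minkowski p p = - 1" and \<nu>: "minkowski \<nu> \<nu> = 1" "minkowski \<nu> p = 0"
    and E: "\<And>i j. i \<in> Basis \<Longrightarrow> j \<in> Basis \<Longrightarrow> minkowski (E i) (E j) = (if i = j then 1 else 0)"
      "\<And>i. i \<in> Basis \<Longrightarrow> minkowski (E i) p = 0" "\<And>i. i \<in> Basis \<Longrightarrow> minkowski (E i) \<nu> = 0"
  shows "z = - minkowski z p *\<^sub>R p + minkowski z \<nu> *\<^sub>R \<nu> + (\<Sum>i\<in>Basis. minkowski z (E i) *\<^sub>R E i)"
proof -
  have comm: "minkowski p \<nu> = 0" "\<And>i. i \<in> Basis \<Longrightarrow> minkowski p (E i) = 0"
    "\<And>i. i \<in> Basis \<Longrightarrow> minkowski \<nu> (E i) = 0"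
    using \<nu> E by (auto simp: minkowski_commute)
  let ?B = "insert p (insert \<nu> (E ` Basis))"
  let ?z = "- minkowski z p *\<^sub>R p + minkowski z \<nu> *\<^sub>R \<nu> + (\<Sum>i\<in>Basis. minkowski z (E i) *\<^sub>R E i)"
  have "inj_on E Basis"
    by (rule inj_onI) (metis E(1) zero_neq_one)
  moreover have "p \<noteq> \<nu>" "p \<notin> E ` Basis"
    using p \<nu> E by auto
  moreover have "\<nu> \<notin> E ` Basis"
    using \<nu>(1) E(3) by (metis imageE zero_neq_one)
  ultimately have card: "card ?B = DIM('a) + 1"
    using dim by (simp add: card_image)
  have "z - ?z = 0"
  proof (rule minkowski_orthogonal_basis_eq_0[OF _ card])
    show "minkowski b c = 0" if "b \<in> ?B" "c \<in> ?B" "b \<noteq> c" for b c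
      using that by (elim insertE imageE) (simp_all add: \<nu> E comm, metis)
    show "minkowski b b \<noteq> 0" if "b \<in> ?B" for b
      using that by (elim insertE imageE) (simp_all add: p \<nu> E)
    have "(\<Sum>i\<in>Basis. minkowski z (E i) * minkowski (E i) (E j)) = minkowski z (E j)"
      if "j \<in> Basis" for j
      using that by (simp add: E if_distrib[of "\<lambda>x. _ * x"] cong: if_cong)
    then show "minkowski (z - ?z) b = 0" if "b \<in> ?B" for b
      using that
      by (elim insertE imageE)
        (simp_all add: p \<nu> E comm minkowski.add_left minkowski.diff_left minkowski.minus_left
          minkowski.scaleR_left minkowski.sum_left)
  qed auto
  then show ?thesis
    by (simp only: right_minus_eq)
qed

section \<open>Twice differentiable parametrisations\<close>

definition twice_differentiable_on ::
  "'m::euclidean_space set \<Rightarrow> ('m \<Rightarrow> 'b::real_normed_vector) \<Rightarrow> bool" where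
  "twice_differentiable_on V G \<longleftrightarrow>
     (\<forall>x\<in>V. G differentiable at x \<and> (\<forall>v. (\<lambda>y. frechet_derivative G (at y) v) differentiable at x))"

lemma twice_differentiable_onD:
  assumes "twice_differentiable_on V G" "x \<in> V"
  shows "(G has_derivative frechet_derivative G (at x)) (at x)"
    and "((\<lambda>y. frechet_derivative G (at y) v) has_derivative
           frechet_derivative (\<lambda>y. frechet_derivative G (at y) v) (at x)) (at x)"
  using assms unfolding twice_differentiable_on_def by (blast intro: frechet_derivative_works[THEN iffD1])+

lemma has_derivative_within_open_Times_slice:
  assumes "open V" "t \<in> I" "x \<in> V"
    and "(\<Psi> has_derivative D) (at (x, t) within V \<times> I)"
  shows "((\<lambda>y. \<Psi> (y, t)) has_derivative (\<lambda>v. D (v, 0))) (at x)"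
proof -
  have "((\<lambda>y. (y, t)) has_derivative (\<lambda>v. (v, 0))) (at x within V)"
    by (intro has_derivative_Pair has_derivative_ident has_derivative_const)
  moreover have "(\<Psi> has_derivative D) (at (x, t) within (\<lambda>y. (y, t)) ` V)"
    by (rule has_derivative_subset[OF assms(4)]) (use assms(2) in auto)
  ultimately have "((\<lambda>y. \<Psi> (y, t)) has_derivative (\<lambda>v. D (v, 0))) (at x within V)"
    by (rule has_derivative_in_compose[where g = \<Psi>])
  then show ?thesis
    by (simp only: at_within_open[OF assms(3,1)])
qed

text \<open>Smoothness is given within space-time, whereas the fundamental forms use full spatial
  derivatives at a fixed time. Since \<open>V\<close> is open, the slice derivative in direction
  \<open>v\<close> is unique and equals the space-time derivative in direction
  \<open>(v, 0)\<close>; this is applied twice.\<close>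

lemma smooth_on_imp_twice_differentiable_on_slice:
  fixes \<Psi> :: "'m::euclidean_space \<times> real \<Rightarrow> 'b::real_normed_vector"
  assumes "smooth_on (V \<times> I) \<Psi>" "open V" "t \<in> I"
  shows "twice_differentiable_on V (\<lambda>x. \<Psi> (x, t))"
proof -
  have "Ck_on (Suc (Suc 0)) (V \<times> I) \<Psi>"
    using assms(1) unfolding smooth_on_def by blast
  then obtain D where D: "\<And>z. z \<in> V \<times> I \<Longrightarrow> (\<Psi> has_derivative D z) (at z within V \<times> I)"
    and C1: "\<And>v. Ck_on (Suc 0) (V \<times> I) (\<lambda>z. D z v)"
    by (subst (asm) Ck_on.simps(2)) blast
  have deriv: "((\<lambda>x. \<Psi> (x, t)) has_derivative (\<lambda>v. D (x, t) (v, 0))) (at x)" if "x \<in> V" for x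
    using has_derivative_within_open_Times_slice[OF assms(2,3) that D] that assms(3) by auto
  have frechet: "frechet_derivative (\<lambda>x. \<Psi> (x, t)) (at x) = (\<lambda>v. D (x, t) (v, 0))" if "x \<in> V" for x
    using frechet_derivative_at[OF deriv[OF that]] by simp
  have "(\<lambda>y. frechet_derivative (\<lambda>x. \<Psi> (x, t)) (at y) v) differentiable at x" if "x \<in> V" for x v
  proof -
    from C1[of "(v, 0)"] obtain D'
      where "\<And>z. z \<in> V \<times> I \<Longrightarrow> ((\<lambda>z. D z (v, 0)) has_derivative D' z) (at z within V \<times> I)"
      by (subst (asm) Ck_on.simps(2)) blast
    then have "((\<lambda>y. D (y, t) (v, 0)) has_derivative (\<lambda>w. D' (x, t) (w, 0))) (at x)"
      using assms(2,3) that by (intro has_derivative_within_open_Times_slice) auto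
    then have "((\<lambda>y. frechet_derivative (\<lambda>x. \<Psi> (x, t)) (at y) v) has_derivative
        (\<lambda>w. D' (x, t) (w, 0))) (at x)"
      by (rule has_derivative_transform_within_open[OF _ assms(2) that]) (simp add: frechet)
    then show ?thesis
      by (rule differentiableI)
  qed
  with deriv show ?thesis
    unfolding twice_differentiable_on_def differentiable_def by blast
qed

section \<open>Second-order conditions at a maximum\<close>

lemma has_vector_derivative_along_line:
  assumes "(f has_derivative f') (at (x + s *\<^sub>R v))"
  shows "((\<lambda>s. f (x + s *\<^sub>R v)) has_vector_derivative f' v) (at s)"
proof -
  have "((\<lambda>s. x + s *\<^sub>R v) has_derivative (\<lambda>h. h *\<^sub>R v)) (at s)"
    by (auto intro!: derivative_eq_intros)
  from has_derivative_compose[OF this assms]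
  show ?thesis
    using linear_scale[OF has_derivative_linear[OF assms]] by (simp add: has_vector_derivative_def)
qed

text \<open>The second derivative is available only at \<open>0\<close>, and that suffices: if it
  were positive, \<open>g'\<close> would be positive just to the right of its zero, so
  \<open>g\<close> would increase there.\<close>

lemma second_derivative_nonpos_at_local_max:
  fixes g :: "real \<Rightarrow> real"
  assumes "\<delta> > 0"
    and g: "\<And>s. \<bar>s\<bar> < \<delta> \<Longrightarrow> (g has_real_derivative g' s) (at s)"
    and max: "\<And>s. \<bar>s\<bar> < \<delta> \<Longrightarrow> g s \<le> g 0"
    and g': "(g' has_real_derivative g2) (at 0)"
  shows "g' 0 = 0" and "g2 \<le> 0"
proof -
  show 0: "g' 0 = 0"
    using DERIV_local_max[OF g[of 0] \<open>\<delta> > 0\<close>] max \<open>\<delta> > 0\<close> by auto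
  show "g2 \<le> 0"
  proof (rule ccontr)
    assume "\<not> g2 \<le> 0"
    then obtain e where "e > 0" and e: "\<And>h. 0 < h \<Longrightarrow> h < e \<Longrightarrow> g' 0 < g' h"
      using has_real_derivative_pos_inc_right[OF g'] by auto
    define r where "r = min \<delta> e / 2"
    have r: "0 < r" "r < \<delta>" "r < e"
      using \<open>\<delta> > 0\<close> \<open>e > 0\<close> by (auto simp: r_def)
    have "g 0 < g r"
    proof (rule DERIV_pos_imp_increasing_open[OF r(1)])
      show "\<exists>y. (g has_real_derivative y) (at s) \<and> 0 < y" if "0 < s" "s < r" for s
        using g[of s] e[of s] that r 0 by force
      show "continuous_on {0..r} g"
        using r by (intro DERIV_continuous_on[where D = g'] has_field_derivative_at_within[OF g]) auto
    qed
    with max[of r] r show False by simp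
  qed
qed

text \<open>A nearest pair of points maximises the form, because \<open>minkowski\<close> is minus
  the \<open>cosh\<close> of the distance. The one-variable test is applied along two lines
  traversed simultaneously, one in each parameter domain; moving both points is what creates the
  mixed term.\<close>

lemma minkowski_second_derivative_test:
  fixes G1 :: "'m::euclidean_space \<Rightarrow> 'a::euclidean_space \<times> real"
    and G2 :: "'n::euclidean_space \<Rightarrow> 'a \<times> real"
  assumes V1: "open V1" "x \<in> V1" "twice_differentiable_on V1 G1"
    and V2: "open V2" "y \<in> V2" "twice_differentiable_on V2 G2"
    and max: "\<And>x' y'. x' \<in> V1 \<Longrightarrow> y' \<in> V2 \<Longrightarrow> minkowski (G1 x') (G2 y') \<le> minkowski (G1 x) (G2 y)"
  shows "minkowski (frechet_derivative G1 (at x) v) (G2 y)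
           + minkowski (G1 x) (frechet_derivative G2 (at y) w) = 0"
    and "minkowski (frechet_derivative (\<lambda>z. frechet_derivative G1 (at z) v) (at x) v) (G2 y)
           + 2 * minkowski (frechet_derivative G1 (at x) v) (frechet_derivative G2 (at y) w)
           + minkowski (G1 x) (frechet_derivative (\<lambda>z. frechet_derivative G2 (at z) w) (at y) w) \<le> 0"
proof -
  let ?S = "(\<lambda>s. x + s *\<^sub>R v) -` V1 \<inter> (\<lambda>s. y + s *\<^sub>R w) -` V2"
  have "open ?S"
    using V1 V2 by (intro open_Int open_vimage continuous_intros)
  moreover have "0 \<in> ?S"
    using V1 V2 by simp
  ultimately obtain \<delta> where "\<delta> > 0" and "ball 0 \<delta> \<subseteq> ?S"
    by (rule openE)
  then have \<delta>: "x + s *\<^sub>R v \<in> V1" "y + s *\<^sub>R w \<in> V2" if "\<bar>s\<bar> < \<delta>" for s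
    using that by (auto simp: subset_iff dist_real_def)
  define g where "g s = minkowski (G1 (x + s *\<^sub>R v)) (G2 (y + s *\<^sub>R w))" for s
  define g' where "g' s =
      minkowski (G1 (x + s *\<^sub>R v)) (frechet_derivative G2 (at (y + s *\<^sub>R w)) w)
      + minkowski (frechet_derivative G1 (at (x + s *\<^sub>R v)) v) (G2 (y + s *\<^sub>R w))" for s
  note line = has_vector_derivative_along_line
  have g: "(g has_real_derivative g' s) (at s)" if "\<bar>s\<bar> < \<delta>" for s
    unfolding g_def g'_def has_real_derivative_iff_has_vector_derivative
    by (intro minkowski.has_vector_derivative line twice_differentiable_onD(1)[OF V1(3)]
        twice_differentiable_onD(1)[OF V2(3)] \<delta> that)
  have max': "g s \<le> g 0" if "\<bar>s\<bar> < \<delta>" for s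
    using max \<delta>[OF that] by (simp add: g_def)
  have x0: "x + 0 *\<^sub>R v \<in> V1" and y0: "y + 0 *\<^sub>R w \<in> V2"
    using V1 V2 by auto
  note ds = line[OF twice_differentiable_onD(1)[OF V1(3) x0]]
    line[OF twice_differentiable_onD(1)[OF V2(3) y0]]
    line[OF twice_differentiable_onD(2)[OF V1(3) x0, of v]]
    line[OF twice_differentiable_onD(2)[OF V2(3) y0, of w]]
  note g'_deriv = has_vector_derivative_add[OF minkowski.has_vector_derivative[OF ds(1,4)]
      minkowski.has_vector_derivative[OF ds(3,2)],
      folded g'_def has_real_derivative_iff_has_vector_derivative]
  note * = second_derivative_nonpos_at_local_max[OF \<open>\<delta> > 0\<close> g max' g'_deriv]
  show "minkowski (frechet_derivative G1 (at x) v) (G2 y)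
           + minkowski (G1 x) (frechet_derivative G2 (at y) w) = 0"
    using *(1) by (simp add: g'_def)
  show "minkowski (frechet_derivative (\<lambda>z. frechet_derivative G1 (at z) v) (at x) v) (G2 y)
           + 2 * minkowski (frechet_derivative G1 (at x) v) (frechet_derivative G2 (at y) w)
           + minkowski (G1 x) (frechet_derivative (\<lambda>z. frechet_derivative G2 (at z) w) (at y) w) \<le> 0"
    using *(2) by simp
qed

text \<open>Both equations come from differentiating the constant
  \<open>minkowski (G z) (G z)\<close>, once and twice. The second one expresses the second
  fundamental form of the hyperboloid itself in Minkowski space.\<close>

lemma
  fixes G :: "'m::euclidean_space \<Rightarrow> 'a::euclidean_space \<times> real"
  assumes V: "open V" "twice_differentiable_on V G"
    and G: "\<And>z. z \<in> V \<Longrightarrow> minkowski (G z) (G z) = - 1"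
    and x: "x \<in> V"
  shows minkowski_frechet_derivative_position: "minkowski (frechet_derivative G (at x) v) (G x) = 0"
    and minkowski_second_derivative_position:
      "minkowski (frechet_derivative (\<lambda>z. frechet_derivative G (at z) v) (at x) w) (G x)
         = - first_fundamental_form G x v w"
proof -
  have orth: "minkowski (frechet_derivative G (at z) v) (G z) = 0" if "z \<in> V" for z v
  proof -
    note d = twice_differentiable_onD(1)[OF V(2) that]
    have "((\<lambda>z. minkowski (G z) (G z)) has_derivative (\<lambda>v. 0)) (at z)"
      by (rule has_derivative_transform_within_open[OF has_derivative_const V(1) that])
         (simp add: G)
    from fun_cong[OF has_derivative_unique[OF this minkowski.FDERIV[OF d d]], of v]
    show ?thesis by (simp add: minkowski_commute)
  qed
  show "minkowski (frechet_derivative G (at x) v) (G x) = 0"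
    by (rule orth[OF x])
  have "((\<lambda>z. minkowski (frechet_derivative G (at z) v) (G z)) has_derivative (\<lambda>v. 0)) (at x)"
    by (rule has_derivative_transform_within_open[OF has_derivative_const V(1) x]) (simp add: orth)
  from fun_cong[OF has_derivative_unique[OF this minkowski.FDERIV[OF
        twice_differentiable_onD(2)[OF V(2) x] twice_differentiable_onD(1)[OF V(2) x]]], of w]
  show "minkowski (frechet_derivative (\<lambda>z. frechet_derivative G (at z) v) (at x) w) (G x)
         = - first_fundamental_form G x v w"
    by (simp add: first_fundamental_form_def)
qed

text \<open>Linearity in the last argument is that of a derivative. In the other argument it holds
  because the first derivative is linear at every point of the open set \<open>V\<close>, so the
  identity may be differentiated.\<close>

lemma second_fundamental_form_sum:
  fixes G :: "'m::euclidean_space \<Rightarrow> 'a::euclidean_space \<times> real"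
  assumes V: "open V" "twice_differentiable_on V G" and x: "x \<in> V" and "finite J"
  shows "second_fundamental_form G x \<nu> (\<Sum>j\<in>J. c j *\<^sub>R f j) (\<Sum>j\<in>J. c j *\<^sub>R f j)
     = (\<Sum>j\<in>J. \<Sum>k\<in>J. c j * c k * second_fundamental_form G x \<nu> (f j) (f k))"
proof -
  let ?w = "\<Sum>j\<in>J. c j *\<^sub>R f j"
  let ?D = "\<lambda>v. frechet_derivative (\<lambda>z. frechet_derivative G (at z) v) (at x)"
  have "((\<lambda>z. frechet_derivative G (at z) ?w) has_derivative (\<lambda>w. \<Sum>j\<in>J. c j *\<^sub>R ?D (f j) w)) (at x)"
  proof (rule has_derivative_transform_within_open[OF _ V(1) x])
    show "((\<lambda>z. \<Sum>j\<in>J. c j *\<^sub>R frechet_derivative G (at z) (f j)) has_derivative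
        (\<lambda>w. \<Sum>j\<in>J. c j *\<^sub>R ?D (f j) w)) (at x)"
      by (intro has_derivative_sum has_derivative_scaleR_right twice_differentiable_onD(2)[OF V(2) x])
    show "(\<Sum>j\<in>J. c j *\<^sub>R frechet_derivative G (at z) (f j)) = frechet_derivative G (at z) ?w"
      if "z \<in> V" for z
      using has_derivative_linear[OF twice_differentiable_onD(1)[OF V(2) that]]
      by (simp only: linear_sum linear_scale)
  qed
  then have 1: "?D ?w = (\<lambda>w. \<Sum>j\<in>J. c j *\<^sub>R ?D (f j) w)"
    by (rule frechet_derivative_at[symmetric])
  have 2: "?D v ?w = (\<Sum>k\<in>J. c k *\<^sub>R ?D v (f k))" for v
    using has_derivative_linear[OF twice_differentiable_onD(2)[OF V(2) x]]
    by (simp only: linear_sum linear_scale)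
  show ?thesis
    unfolding second_fundamental_form_def 1 2
    by (simp add: minkowski.sum_left minkowski.scaleR_left sum_distrib_left mult.assoc flip: sum_negf)
qed

section \<open>The minimum of the distance at a fixed time\<close>

lemma mean_curvatureE:
  fixes G :: "'m::euclidean_space \<Rightarrow> 'a::euclidean_space \<times> real"
  assumes "mean_curvature G x \<nu> H"
  obtains k :: "'m \<Rightarrow> real" and e :: "'m \<Rightarrow> 'm" where "H = (\<Sum>i\<in>Basis. k i) / real DIM('m)"
    and "\<And>i j. i \<in> Basis \<Longrightarrow> j \<in> Basis \<Longrightarrow>
      first_fundamental_form G x (e i) (e j) = (if i = j then 1 else 0)"
    and "\<And>i j. i \<in> Basis \<Longrightarrow> j \<in> Basis \<Longrightarrow>
      second_fundamental_form G x \<nu> (e i) (e j) = (if i = j then k i else 0)"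
proof -
  from assms obtain k where k: "principal_curvatures G x \<nu> k"
    and H: "H = (\<Sum>i\<in>Basis. k i) / real DIM('m)"
    unfolding mean_curvature_def by blast
  from k obtain e where "\<forall>i\<in>Basis. \<forall>j\<in>Basis.
      first_fundamental_form G x (e i) (e j) = (if i = j then 1 else 0) \<and>
      second_fundamental_form G x \<nu> (e i) (e j) = (if i = j then k i else 0)"
    unfolding principal_curvatures_def by (elim exE)
  then show thesis
    by (intro that[OF H, of e]) blast+
qed

text \<open>
  The principal frames \<open>e\<close>, \<open>f\<close> of the two hypersurfaces span the same space but differ by an
  orthogonal matrix \<open>R\<close>, so the direction \<open>w i\<close> that moves the second point in parallel to \<open>e i\<close> is
  expanded in \<open>f\<close>; the sum over \<open>i\<close> still gives the trace of the second fundamental form.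
\<close>

lemma mean_curvature_velocity_at_minimum:
  fixes G1 G2 :: "'m::euclidean_space \<Rightarrow> 'a::euclidean_space \<times> real"
  assumes dim: "DIM('a) = DIM('m) + 1"
    and V1: "open V1" "x \<in> V1" "twice_differentiable_on V1 G1"
    and V2: "open V2" "y \<in> V2" "twice_differentiable_on V2 G2"
    and G1: "\<And>z. z \<in> V1 \<Longrightarrow> minkowski (G1 z) (G1 z) = - 1"
    and G2: "\<And>z. z \<in> V2 \<Longrightarrow> minkowski (G2 z) (G2 z) = - 1"
    and \<nu>1: "unit_normal G1 x \<nu>1" and H1: "mean_curvature G1 x \<nu>1 H1"
    and \<nu>2: "unit_normal G2 y \<nu>2" and H2: "mean_curvature G2 y \<nu>2 H2"
    and max: "\<And>x' y'. x' \<in> V1 \<Longrightarrow> y' \<in> V2 \<Longrightarrow> minkowski (G1 x') (G2 y') \<le> minkowski (G1 x) (G2 y)"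
    and disjoint: "minkowski (G1 x) (G2 y) < - 1"
  shows "H1 * minkowski \<nu>1 (G2 y) + H2 * minkowski (G1 x) \<nu>2 \<ge> 2 * (minkowski (G1 x) (G2 y) + 1)"
proof -
  define p q where "p = G1 x" and "q = G2 y"
  define W where "W = - minkowski p q"
  define b1 b2 where "b1 = minkowski q \<nu>1" and "b2 = minkowski p \<nu>2"
  let ?D1 = "frechet_derivative G1 (at x)" and ?D2 = "frechet_derivative G2 (at y)"
  let ?D1' = "\<lambda>v. frechet_derivative (\<lambda>z. frechet_derivative G1 (at z) v) (at x)"
  let ?D2' = "\<lambda>v. frechet_derivative (\<lambda>z. frechet_derivative G2 (at z) v) (at y)"
  obtain k1 :: "'m \<Rightarrow> real" and e :: "'m \<Rightarrow> 'm" where H1_eq: "H1 = (\<Sum>i\<in>Basis. k1 i) / real DIM('m)"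
    and e: "\<And>i j. i \<in> Basis \<Longrightarrow> j \<in> Basis \<Longrightarrow>
        first_fundamental_form G1 x (e i) (e j) = (if i = j then 1 else 0)"
      "\<And>i j. i \<in> Basis \<Longrightarrow> j \<in> Basis \<Longrightarrow>
        second_fundamental_form G1 x \<nu>1 (e i) (e j) = (if i = j then k1 i else 0)"
    using mean_curvatureE[OF H1] by blast
  obtain k2 :: "'m \<Rightarrow> real" and f :: "'m \<Rightarrow> 'm" where H2_eq: "H2 = (\<Sum>i\<in>Basis. k2 i) / real DIM('m)"
    and f: "\<And>i j. i \<in> Basis \<Longrightarrow> j \<in> Basis \<Longrightarrow>
        first_fundamental_form G2 y (f i) (f j) = (if i = j then 1 else 0)"
      "\<And>i j. i \<in> Basis \<Longrightarrow> j \<in> Basis \<Longrightarrow>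
        second_fundamental_form G2 y \<nu>2 (f i) (f j) = (if i = j then k2 i else 0)"
    using mean_curvatureE[OF H2] by blast
  define E F where "E i = ?D1 (e i)" and "F i = ?D2 (f i)" for i
  have EE: "minkowski (E i) (E j) = (if i = j then 1 else 0)" if "i \<in> Basis" "j \<in> Basis" for i j
    using e(1)[OF that] by (simp add: first_fundamental_form_def E_def)
  have FF: "minkowski (F i) (F j) = (if i = j then 1 else 0)" if "i \<in> Basis" "j \<in> Basis" for i j
    using f(1)[OF that] by (simp add: first_fundamental_form_def F_def)
  have pp: "minkowski p p = - 1" and qq: "minkowski q q = - 1"
    using G1 V1 G2 V2 by (auto simp: p_def q_def)
  have n1: "minkowski \<nu>1 \<nu>1 = 1" "minkowski \<nu>1 p = 0" "minkowski (?D1 v) \<nu>1 = 0" for v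
    using \<nu>1 by (auto simp: unit_normal_def p_def minkowski_commute)
  have n2: "minkowski \<nu>2 \<nu>2 = 1" "minkowski \<nu>2 q = 0" "minkowski (?D2 v) \<nu>2 = 0" for v
    using \<nu>2 by (auto simp: unit_normal_def q_def minkowski_commute)
  note lin1 = has_derivative_linear[OF twice_differentiable_onD(1)[OF V1(3,2)]]
  note lin2 = has_derivative_linear[OF twice_differentiable_onD(1)[OF V2(3,2)]]
  note test = minkowski_second_derivative_test[OF V1 V2 max, folded p_def q_def]
  \<comment> \<open>Setting one of the two directions to zero splits the first-order condition: each
    tangent space is orthogonal to the other point as well.\<close>
  have Dq: "minkowski (?D1 v) q = 0" for v
    using test(1)[of v 0] by (simp add: linear_0[OF lin2] minkowski.zero_right)
  have Dp: "minkowski (?D2 v) p = 0" for v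
    using test(1)[of 0 v] by (simp add: linear_0[OF lin1] minkowski.zero_left minkowski_commute)
  have E_p: "minkowski (E i) p = 0" and F_q: "minkowski (F i) q = 0" for i
    using minkowski_frechet_derivative_position[OF V1(1,3) G1 V1(2)]
      minkowski_frechet_derivative_position[OF V2(1,3) G2 V2(2)]
    by (simp_all add: E_def F_def p_def q_def)
  have E_n: "minkowski (E i) \<nu>1 = 0" and F_n: "minkowski (F i) \<nu>2 = 0" for i
    by (simp_all add: E_def F_def n1 n2)
  note expand1 = minkowski_orthonormal_expansion[OF dim pp n1(1,2) EE E_p E_n]
  note expand2 = minkowski_orthonormal_expansion[OF dim qq n2(1,2) FF F_q F_n]
  \<comment> \<open>All tangential coefficients vanish, so the geodesic from \<open>p\<close> to
    \<open>q\<close> leaves along the normal: \<open>W\<close> is the \<open>cosh\<close> of the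
    distance and \<open>b1\<close> is its \<open>sinh\<close> up to sign.\<close>
  have q_eq: "q = W *\<^sub>R p + b1 *\<^sub>R \<nu>1"
    using expand1[of q] Dq by (simp add: W_def b1_def E_def minkowski_commute[of q])
  have p_eq: "p = W *\<^sub>R q + b2 *\<^sub>R \<nu>2"
    using expand2[of p] Dp by (simp add: W_def b2_def F_def minkowski_commute[of p])
  have b1_sq: "b1 * b1 = W * W - 1"
  proof -
    have "minkowski q q = minkowski q (W *\<^sub>R p + b1 *\<^sub>R \<nu>1)"
      by (rule arg_cong[OF q_eq])
    then show ?thesis
      by (simp add: qq minkowski.add_right minkowski.scaleR_right minkowski_commute[of q p] flip: b1_def W_def)
        (simp add: W_def minkowski_commute[of q p])
  qed
  have b2_sq: "b2 * b2 = W * W - 1"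
  proof -
    have "minkowski p p = minkowski p (W *\<^sub>R q + b2 *\<^sub>R \<nu>2)"
      by (rule arg_cong[OF p_eq])
    then show ?thesis
      by (simp add: pp minkowski.add_right minkowski.scaleR_right minkowski_commute[of q p] flip: b2_def W_def)
        (simp add: W_def minkowski_commute[of q p])
  qed
  have W: "W > 1"
    using disjoint by (simp add: W_def p_def q_def)
  then have "W * W > 1"
    by (rule less_1_mult[OF _ W])
  then have b_nz: "b1 \<noteq> 0" "b2 \<noteq> 0"
    using b1_sq b2_sq by auto
  \<comment> \<open>As \<open>b1\<close> is nonzero, orthogonality to \<open>p\<close> and
    \<open>q\<close> forces orthogonality to \<open>\<nu>1\<close>. With the symmetric statement for
    \<open>E\<close>, both tangent spaces are the orthogonal complement of the plane of
    \<open>p\<close> and \<open>q\<close>, so each frame can be expanded in the other.\<close>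
  have F_n1: "minkowski (F i) \<nu>1 = 0" for i
  proof -
    have "0 = minkowski (F i) (W *\<^sub>R p + b1 *\<^sub>R \<nu>1)"
      using F_q q_eq by simp
    then show ?thesis
      using b_nz Dp by (simp add: minkowski.add_right minkowski.scaleR_right F_def)
  qed
  have E_n2: "minkowski (E i) \<nu>2 = 0" for i
  proof -
    have "0 = minkowski (E i) (W *\<^sub>R q + b2 *\<^sub>R \<nu>2)"
      using E_p p_eq by simp
    then show ?thesis
      using b_nz Dq by (simp add: minkowski.add_right minkowski.scaleR_right E_def)
  qed
  define R where "R i j = minkowski (E i) (F j)" for i j
  have E_eq: "E i = (\<Sum>j\<in>Basis. R i j *\<^sub>R F j)" for i
    using expand2[of "E i"] Dq E_n2 by (simp add: E_def R_def)
  have F_eq: "F j = (\<Sum>i\<in>Basis. R i j *\<^sub>R E i)" for j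
    using expand1[of "F j"] Dp F_n1 by (simp add: F_def R_def minkowski_commute)
  have R_col: "(\<Sum>i\<in>Basis. R i j * R i j) = 1" if "j \<in> Basis" for j
  proof -
    have "1 = minkowski (\<Sum>i\<in>Basis. R i j *\<^sub>R E i) (F j)"
      using FF[OF that that] by (simp flip: F_eq)
    then show ?thesis
      by (simp add: minkowski.sum_left minkowski.scaleR_left R_def)
  qed
  define w where "w i = (\<Sum>j\<in>Basis. R i j *\<^sub>R f j)" for i
  have Dw: "?D2 (w i) = E i" for i
    unfolding w_def E_eq[of i] F_def by (simp only: linear_sum[OF lin2] linear_scale[OF lin2])
  \<comment> \<open>By \<open>q_eq\<close> the pairing with \<open>q\<close> splits into a part
    along \<open>p\<close>, where the hyperboloid contributes \<open>- W\<close>, and a part along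
    the normal, where the principal curvature appears.\<close>
  have D1: "minkowski (?D1' (e i) (e i)) q = - W - b1 * k1 i" if "i \<in> Basis" for i
  proof -
    have "minkowski (?D1' (e i) (e i)) p = - 1"
      using minkowski_second_derivative_position[OF V1(1,3) G1 V1(2), of "e i" "e i"] e(1)[OF that that]
      by (simp add: p_def)
    moreover have "minkowski (?D1' (e i) (e i)) \<nu>1 = - k1 i"
      using e(2)[OF that that] by (simp add: second_fundamental_form_def)
    ultimately show ?thesis
      by (subst q_eq) (simp add: minkowski.add_right minkowski.scaleR_right)
  qed
  have D2: "minkowski p (?D2' (w i) (w i)) = - W - b2 * (\<Sum>j\<in>Basis. R i j * R i j * k2 j)"
    if "i \<in> Basis" for i
  proof -
    have "minkowski (?D2' (w i) (w i)) q = - 1"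
      using minkowski_second_derivative_position[OF V2(1,3) G2 V2(2), of "w i" "w i"] EE[OF that that]
      by (simp add: q_def first_fundamental_form_def Dw)
    moreover have "minkowski (?D2' (w i) (w i)) \<nu>2 = - (\<Sum>j\<in>Basis. R i j * R i j * k2 j)"
    proof -
      have "second_fundamental_form G2 y \<nu>2 (w i) (w i)
          = (\<Sum>j\<in>Basis. \<Sum>k\<in>Basis. R i j * R i k * second_fundamental_form G2 y \<nu>2 (f j) (f k))"
        unfolding w_def by (rule second_fundamental_form_sum[OF V2(1,3,2) finite_Basis])
      also have "\<dots> = (\<Sum>j\<in>Basis. \<Sum>k\<in>Basis. if j = k then R i j * R i j * k2 j else 0)"
        by (intro sum.cong refl) (simp add: f(2))
      finally show ?thesis
        by (simp add: second_fundamental_form_def)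
    qed
    ultimately show ?thesis
      unfolding minkowski_commute[of p]
      by (subst p_eq) (simp add: minkowski.add_right minkowski.scaleR_right)
  qed
  \<comment> \<open>Summing the second-order inequality over the frame produces traces. Parallel
    motion makes each mixed term equal to \<open>2\<close>, whence the summand
    \<open>2 * (1 - W)\<close> for every direction.\<close>
  have "0 \<ge> (\<Sum>i\<in>Basis. minkowski (?D1' (e i) (e i)) q + 2 * minkowski (?D1 (e i)) (?D2 (w i))
      + minkowski p (?D2' (w i) (w i)))"
    by (intro sum_nonpos test(2))
  also have "(\<Sum>i\<in>Basis. minkowski (?D1' (e i) (e i)) q + 2 * minkowski (?D1 (e i)) (?D2 (w i))
      + minkowski p (?D2' (w i) (w i)))
      = (\<Sum>i\<in>Basis. 2 * (1 - W) - b1 * k1 i - b2 * (\<Sum>j\<in>Basis. R i j * R i j * k2 j))"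
    by (intro sum.cong refl) (simp add: D1 D2 Dw EE flip: E_def)
  also have "\<dots> = 2 * (1 - W) * DIM('m) - b1 * (\<Sum>i\<in>Basis. k1 i)
      - b2 * (\<Sum>i\<in>Basis. \<Sum>j\<in>Basis. R i j * R i j * k2 j)"
    by (simp add: sum_subtractf sum_distrib_left)
  \<comment> \<open>Exchanging the sums isolates the squared column norms of \<open>R\<close>, which
    are \<open>1\<close>, and leaves the trace.\<close>
  also have "(\<Sum>i\<in>Basis. \<Sum>j\<in>Basis. R i j * R i j * k2 j)
      = (\<Sum>j\<in>Basis. (\<Sum>i\<in>Basis. R i j * R i j) * k2 j)"
    unfolding sum_distrib_right by (rule sum.swap)
  also have "\<dots> = (\<Sum>j\<in>Basis. k2 j)"
    by (intro sum.cong refl) (simp add: R_col)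
  also have "2 * (1 - W) * DIM('m) - b1 * (\<Sum>i\<in>Basis. k1 i) - b2 * (\<Sum>j\<in>Basis. k2 j)
      = DIM('m) * (2 * (1 - W) - H1 * b1 - H2 * b2)"
    by (simp add: H1_eq H2_eq field_simps)
  finally have "2 * (1 - W) - H1 * b1 - H2 * b2 \<le> 0"
    by (simp add: mult_le_0_iff)
  then show ?thesis
    by (simp add: W_def b1_def b2_def p_def q_def minkowski_commute)
qed

section \<open>Charts of a mean curvature flow\<close>

lemma smooth_manifold_chart_at:
  assumes "smooth_manifold N \<A>" "p \<in> topspace N"
  obtains U \<phi> where "(U, \<phi>) \<in> \<A>" "p \<in> U"
proof -
  have "p \<in> (\<Union>(U, \<phi>)\<in>\<A>. U)"
    using assms unfolding smooth_manifold_def by blast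
  then show thesis
    using that by auto
qed

lemma continuous_on_mean_curvature_flow:
  assumes "mean_curvature_flow N \<A> T F" "smooth_manifold N \<A>" "p \<in> topspace N"
  shows "continuous_on (time_interval T) (F p)"
proof -
  obtain U \<phi> where "(U, \<phi>) \<in> \<A>" "p \<in> U"
    by (rule smooth_manifold_chart_at[OF assms(2,3)])
  then have "\<exists>v. (F p has_vector_derivative v) (at t within time_interval T)"
    if "t \<in> time_interval T" for t
    using assms(1) that unfolding mean_curvature_flow_def Let_def by blast
  then show ?thesis
    unfolding continuous_on_eq_continuous_within by (blast intro: has_vector_derivative_continuous)
qed

lemma
  assumes "smooth_manifold N \<A>" "(U, \<phi>) \<in> \<A>"
  shows chart_domain_openin: "openin N U"
    and chart_image_open: "open (\<phi> ` U)"
    and chart_continuous_map: "continuous_map (subtopology N U) (top_of_set (\<phi> ` U)) \<phi>"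
    and chart_inj_on: "inj_on \<phi> U"
proof -
  have *: "openin N U" "open (\<phi> ` U)"
      "homeomorphic_map (subtopology N U) (top_of_set (\<phi> ` U)) \<phi>"
    using assms unfolding smooth_manifold_def by blast+
  then show "openin N U" "open (\<phi> ` U)"
    by auto
  show "continuous_map (subtopology N U) (top_of_set (\<phi> ` U)) \<phi>"
    by (rule homeomorphic_imp_continuous_map[OF *(3)])
  have "topspace (subtopology N U) = U"
    using openin_subset[OF *(1)] by auto
  with homeomorphic_imp_injective_map[OF *(3)] show "inj_on \<phi> U"
    by simp
qed

text \<open>Joint continuity is local: over a chart domain the flow is its smooth coordinate
  expression composed with the chart, and the pieces agree on overlaps.\<close>

lemma continuous_map_mean_curvature_flow:
  fixes F :: "'p \<Rightarrow> real \<Rightarrow> 'a::euclidean_space \<times> real"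
  assumes man: "smooth_manifold N \<A>" and mcf: "mean_curvature_flow N \<A> T F"
    and J: "J \<subseteq> time_interval T"
  shows "continuous_map (prod_topology N (top_of_set J)) euclidean (\<lambda>(p, t). F p t)"
proof (rule pasting_lemma[where I = \<A> and T = "\<lambda>(U, \<phi>). U \<times> J" and f = "\<lambda>_ (p, t). F p t"])
  show "openin (prod_topology N (top_of_set J)) (case c of (U, \<phi>) \<Rightarrow> U \<times> J)" if "c \<in> \<A>" for c
    using that by (cases c) (auto simp: openin_prod_Times_iff intro: chart_domain_openin[OF man])
  show "continuous_map (subtopology (prod_topology N (top_of_set J)) (case c of (U, \<phi>) \<Rightarrow> U \<times> J))
      euclidean (\<lambda>(p, t). F p t)" if "c \<in> \<A>" for c
  proof -
    obtain U \<phi> where c: "c = (U, \<phi>)" by (cases c)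
    note chart = that[unfolded c]
    let ?X = "prod_topology (subtopology N U) (top_of_set J)"
    let ?\<Psi> = "\<lambda>(x, t). F (inv_into U \<phi> x) t"
    have "smooth_on (\<phi> ` U \<times> time_interval T) ?\<Psi>"
      using mcf chart unfolding mean_curvature_flow_def by blast
    then have "Ck_on 0 (\<phi> ` U \<times> time_interval T) ?\<Psi>"
      unfolding smooth_on_def by blast
    then have "continuous_on (\<phi> ` U \<times> J) ?\<Psi>"
      using J by (auto elim!: continuous_on_subset)
    then have \<Psi>: "continuous_map (prod_topology (top_of_set (\<phi> ` U)) (top_of_set J)) euclidean ?\<Psi>"
      by (simp flip: subtopology_Times)
    have "continuous_map ?X (prod_topology (top_of_set (\<phi> ` U)) (top_of_set J)) (\<lambda>(p, t). (\<phi> p, t))"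
      unfolding continuous_map_prod_top using chart_continuous_map[OF man chart] by simp
    from continuous_map_compose[OF this \<Psi>]
    have "continuous_map ?X euclidean (\<lambda>(p, t). F p t)"
    proof (rule continuous_map_eq)
      show "(?\<Psi> \<circ> (\<lambda>(p, t). (\<phi> p, t))) z = (\<lambda>(p, t). F p t) z" if "z \<in> topspace ?X" for z
        using that chart_inj_on[OF man chart] by (auto simp: inv_into_f_f)
    qed
    then show ?thesis
      by (simp add: c subtopology_Times subtopology_subtopology)
  qed
  show "\<exists>c. c \<in> \<A> \<and> z \<in> (case c of (U, \<phi>) \<Rightarrow> U \<times> J) \<and> (case z of (p, t) \<Rightarrow> F p t) = (case z of (p, t) \<Rightarrow> F p t)"
    if "z \<in> topspace (prod_topology N (top_of_set J))" for z
  proof -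
    from that have "fst z \<in> topspace N" "snd z \<in> J"
      by auto
    then show ?thesis
      by (elim smooth_manifold_chart_at[OF man]) (force simp: mem_Times_iff)
  qed
qed auto

lemma mean_curvature_flow_in_hyperbolic_space:
  assumes "mean_curvature_flow N \<A> T F" "p \<in> topspace N" "t \<in> time_interval T"
  shows "F p t \<in> hyperbolic_space"
  using assms unfolding mean_curvature_flow_def by blast

text \<open>Restates the flow at one point without charts. Since \<open>G\<close> maps
  \<open>V\<close> into the hypersurface at time \<open>t\<close>, an extremum over the hypersurface
  is also one over \<open>V\<close>.\<close>

lemma mean_curvature_flow_local:
  fixes F :: "'p \<Rightarrow> real \<Rightarrow> 'a::euclidean_space \<times> real"
    and \<A> :: "('p set \<times> ('p \<Rightarrow> 'm::euclidean_space)) set"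
  assumes man: "smooth_manifold N \<A>" and mcf: "mean_curvature_flow N \<A> T F"
    and p: "p \<in> topspace N" and t: "t \<in> time_interval T"
  obtains V and x :: 'm and G \<nu> H where "open V" "x \<in> V" "twice_differentiable_on V G"
    and "G ` V \<subseteq> (\<lambda>p. F p t) ` topspace N" "G x = F p t"
    and "unit_normal G x \<nu>" "mean_curvature G x \<nu> H"
    and "(F p has_vector_derivative - (H *\<^sub>R \<nu>)) (at t within time_interval T)"
proof -
  obtain U \<phi> where chart: "(U, \<phi>) \<in> \<A>" and pU: "p \<in> U"
    by (rule smooth_manifold_chart_at[OF man p])
  define G where "G = (\<lambda>x. F (inv_into U \<phi> x) t)"
  obtain \<nu> H where "unit_normal G (\<phi> p) \<nu>" "mean_curvature G (\<phi> p) \<nu> H"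
    "(F p has_vector_derivative - (H *\<^sub>R \<nu>)) (at t within time_interval T)"
    using mcf chart pU t unfolding mean_curvature_flow_def Let_def G_def by blast
  moreover have "open (\<phi> ` U)" "\<phi> p \<in> \<phi> ` U"
    using chart_image_open[OF man chart] pU by auto
  moreover have "twice_differentiable_on (\<phi> ` U) G"
  proof -
    have "smooth_on (\<phi> ` U \<times> time_interval T) (\<lambda>(x, t). F (inv_into U \<phi> x) t)"
      using mcf chart unfolding mean_curvature_flow_def by blast
    from smooth_on_imp_twice_differentiable_on_slice[OF this chart_image_open[OF man chart] t]
    show ?thesis by (simp add: G_def)
  qed
  moreover have "G ` \<phi> ` U \<subseteq> (\<lambda>p. F p t) ` topspace N" "G (\<phi> p) = F p t"
    using chart_inj_on[OF man chart] openin_subset[OF chart_domain_openin[OF man chart]] pU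
    by (auto simp: G_def inv_into_f_f)
  ultimately show thesis
    using that by blast
qed

text \<open>By the product rule and the flow equation, \<open>D\<close> is minus the curvature
  expression bounded below in \<open>mean_curvature_velocity_at_minimum\<close>.\<close>

lemma minkowski_derivative_at_spatial_minimum:
  fixes F1 :: "'p \<Rightarrow> real \<Rightarrow> 'a::euclidean_space \<times> real"
    and \<A>1 :: "('p set \<times> ('p \<Rightarrow> 'm::euclidean_space)) set"
    and \<A>2 :: "('q set \<times> ('q \<Rightarrow> 'm)) set"
  assumes dim: "DIM('a) = DIM('m) + 1"
    and man1: "smooth_manifold N1 \<A>1" and mcf1: "mean_curvature_flow N1 \<A>1 T F1"
    and man2: "smooth_manifold N2 \<A>2" and mcf2: "mean_curvature_flow N2 \<A>2 T F2"
    and p: "p \<in> topspace N1" and q: "q \<in> topspace N2" and t: "t \<in> time_interval T"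
    and max: "\<And>p' q'. p' \<in> topspace N1 \<Longrightarrow> q' \<in> topspace N2 \<Longrightarrow>
      minkowski (F1 p' t) (F2 q' t) \<le> minkowski (F1 p t) (F2 q t)"
    and disjoint: "minkowski (F1 p t) (F2 q t) < - 1"
  obtains D where
    "((\<lambda>s. minkowski (F1 p s) (F2 q s)) has_real_derivative D) (at t within time_interval T)"
    and "D \<le> - 2 * (minkowski (F1 p t) (F2 q t) + 1)"
proof -
  obtain V1 and x :: 'm and G1 \<nu>1 H1 where
    1: "open V1" "x \<in> V1" "twice_differentiable_on V1 G1"
    and G1: "G1 ` V1 \<subseteq> (\<lambda>p. F1 p t) ` topspace N1" "G1 x = F1 p t"
    and H1: "unit_normal G1 x \<nu>1" "mean_curvature G1 x \<nu>1 H1"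
    and d1: "(F1 p has_vector_derivative - (H1 *\<^sub>R \<nu>1)) (at t within time_interval T)"
    by (rule mean_curvature_flow_local[OF man1 mcf1 p t])
  obtain V2 and y :: 'm and G2 \<nu>2 H2 where
    2: "open V2" "y \<in> V2" "twice_differentiable_on V2 G2"
    and G2: "G2 ` V2 \<subseteq> (\<lambda>q. F2 q t) ` topspace N2" "G2 y = F2 q t"
    and H2: "unit_normal G2 y \<nu>2" "mean_curvature G2 y \<nu>2 H2"
    and d2: "(F2 q has_vector_derivative - (H2 *\<^sub>R \<nu>2)) (at t within time_interval T)"
    by (rule mean_curvature_flow_local[OF man2 mcf2 q t])
  have hyp1: "minkowski (G1 z) (G1 z) = - 1" if "z \<in> V1" for z
  proof -
    from that G1(1) obtain p' where "p' \<in> topspace N1" "G1 z = F1 p' t"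
      by blast
    then show ?thesis
      using mean_curvature_flow_in_hyperbolic_space[OF mcf1 _ t, of p'] by (simp add: hyperbolic_space_def)
  qed
  have hyp2: "minkowski (G2 z) (G2 z) = - 1" if "z \<in> V2" for z
  proof -
    from that G2(1) obtain q' where "q' \<in> topspace N2" "G2 z = F2 q' t"
      by blast
    then show ?thesis
      using mean_curvature_flow_in_hyperbolic_space[OF mcf2 _ t, of q'] by (simp add: hyperbolic_space_def)
  qed
  have max': "minkowski (G1 x') (G2 y') \<le> minkowski (G1 x) (G2 y)" if "x' \<in> V1" "y' \<in> V2" for x' y'
  proof -
    from that(1) G1(1) obtain p' where "p' \<in> topspace N1" "G1 x' = F1 p' t"
      by blast
    moreover from that(2) G2(1) obtain q' where "q' \<in> topspace N2" "G2 y' = F2 q' t"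
      by blast
    ultimately show ?thesis
      using max[of p' q'] unfolding G1(2) G2(2) by simp
  qed
  have "((\<lambda>s. minkowski (F1 p s) (F2 q s)) has_real_derivative
      minkowski (F1 p t) (- (H2 *\<^sub>R \<nu>2)) + minkowski (- (H1 *\<^sub>R \<nu>1)) (F2 q t))
      (at t within time_interval T)"
    unfolding has_real_derivative_iff_has_vector_derivative
    by (rule minkowski.has_vector_derivative[OF d1 d2])
  moreover have "H1 * minkowski \<nu>1 (F2 q t) + H2 * minkowski (F1 p t) \<nu>2
      \<ge> 2 * (minkowski (F1 p t) (F2 q t) + 1)"
    using mean_curvature_velocity_at_minimum[OF dim 1 2 hyp1 hyp2 H1 H2 max'] disjoint
    unfolding G1(2) G2(2) by blast
  then have "minkowski (F1 p t) (- (H2 *\<^sub>R \<nu>2)) + minkowski (- (H1 *\<^sub>R \<nu>1)) (F2 q t)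
      \<le> - 2 * (minkowski (F1 p t) (F2 q t) + 1)"
    by (simp add: minkowski.minus_left minkowski.minus_right minkowski.scaleR_left minkowski.scaleR_right)
  ultimately show thesis
    by (rule that)
qed

section \<open>The minimum principle\<close>

text \<open>The initial map is a homeomorphism onto its image, so compactness passes from the
  initial hypersurface to the parameter manifold and thereby serves all later times.\<close>

lemma compact_space_mean_curvature_flow:
  assumes "mean_curvature_flow N \<A> T F" "compact ((\<lambda>p. F p 0) ` topspace N)"
  shows "compact_space N"
proof -
  have "homeomorphic_map N (subtopology (top_of_set hyperbolic_space) ((\<lambda>p. F p 0) ` topspace N)) (\<lambda>p. F p 0)"
    using assms(1) unfolding mean_curvature_flow_def embedding_map_def by blast
  moreover from this have "(\<lambda>p. F p 0) ` topspace N \<subseteq> hyperbolic_space"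
    using homeomorphic_imp_surjective_map by fastforce
  ultimately have "homeomorphic_map N (top_of_set ((\<lambda>p. F p 0) ` topspace N)) (\<lambda>p. F p 0)"
    by (simp add: subtopology_subtopology Int_absorb1)
  from homeomorphic_compact_space[OF homeomorphic_map_imp_homeomorphic_space[OF this]]
  show ?thesis
    using assms(2) by (simp add: compact_space_subtopology)
qed

lemma minkowski_exponential_growth:
  fixes F1 :: "'p \<Rightarrow> real \<Rightarrow> 'a::euclidean_space \<times> real"
    and \<A>1 :: "('p set \<times> ('p \<Rightarrow> 'm::euclidean_space)) set"
    and \<A>2 :: "('q set \<times> ('q \<Rightarrow> 'm)) set"
  assumes dim: "DIM('a) = DIM('m) + 1"
    and man1: "smooth_manifold N1 \<A>1" and mcf1: "mean_curvature_flow N1 \<A>1 T F1"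
    and man2: "smooth_manifold N2 \<A>2" and mcf2: "mean_curvature_flow N2 \<A>2 T F2"
    and compact1: "compact_space N1" and proper2: "proper_flow N2 T F2"
    and initial: "\<And>p q. p \<in> topspace N1 \<Longrightarrow> q \<in> topspace N2 \<Longrightarrow> - minkowski (F1 p 0) (F2 q 0) - 1 \<ge> u"
    and p1: "p1 \<in> topspace N1" and q1: "q1 \<in> topspace N2" and t1: "t1 \<in> time_interval T"
  shows "exp (2 * t1) * (- minkowski (F1 p1 t1) (F2 q1 t1) - 1) \<ge> u"
proof (rule ccontr)
  let ?u = "\<lambda>p q t. - minkowski (F1 p t) (F2 q t) - 1"
  define a where "a = exp (2 * t1) * ?u p1 q1 t1"
  assume "\<not> exp (2 * t1) * ?u p1 q1 t1 \<ge> u"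
  then have "a < u"
    by (simp add: a_def)
  have t1_nonneg: "0 \<le> t1"
    using t1 by (simp add: time_interval_def)
  have J: "{0..t1} \<subseteq> time_interval T"
  proof
    fix s assume "s \<in> {0..t1}"
    then have "0 \<le> s" "ereal s \<le> ereal t1" by auto
    moreover have "ereal t1 < T"
      using t1 by (simp add: time_interval_def)
    ultimately show "s \<in> time_interval T"
      using le_less_trans by (simp only: time_interval_def mem_Collect_eq) blast
  qed
  have u_nonneg: "0 \<le> ?u p q t" if "p \<in> topspace N1" "q \<in> topspace N2" "t \<in> time_interval T" for p q t
    using minkowski_le_neg_1[OF mean_curvature_flow_in_hyperbolic_space[OF mcf1 that(1,3)]
        mean_curvature_flow_in_hyperbolic_space[OF mcf2 that(2,3)]] by simp
  have "0 \<le> a"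
    using u_nonneg[OF p1 q1 t1] by (simp add: a_def)
  \<comment> \<open>The level \<open>c\<close> is halfway between \<open>a\<close> and
    \<open>u\<close>, and the drift \<open>\<epsilon> * t1\<close> is less than half the gap. So
    \<open>h\<close> stays below \<open>c\<close> at the violating point, starts above
    \<open>c\<close>, and \<open>c\<close> exceeds the drift because \<open>a\<close> is
    nonnegative.\<close>
  define c \<epsilon> where "c = (a + u) / 2" and "\<epsilon> = (u - a) / (2 * (t1 + 1))"
  have "\<epsilon> > 0"
    using \<open>a < u\<close> t1_nonneg by (simp add: \<epsilon>_def)
  have "\<epsilon> * t1 < (u - a) / 2"
    using \<open>a < u\<close> t1_nonneg by (simp add: \<epsilon>_def field_simps)
  then have c: "a + \<epsilon> * t1 < c" "\<epsilon> * t1 < c" "c < u" "0 \<le> c"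
    using \<open>a < u\<close> \<open>0 \<le> a\<close> by (simp_all add: c_def field_simps)
  define h where "h p q t = exp (2 * t) * ?u p q t + \<epsilon> * t" for p q t
  let ?J = "top_of_set {0..t1}"
  let ?X = "prod_topology N1 (prod_topology N2 ?J)"

  \<comment> \<open>Joint continuity of \<open>h\<close> in both points and time\<close>
  have cont1: "continuous_map (prod_topology N1 ?J) euclidean (\<lambda>(p, t). F1 p t)"
    by (rule continuous_map_mean_curvature_flow[OF man1 mcf1 J])
  have cont2: "continuous_map (prod_topology N2 ?J) euclidean (\<lambda>(q, t). F2 q t)"
    by (rule continuous_map_mean_curvature_flow[OF man2 mcf2 J])
  have proj_t: "continuous_map ?X ?J (\<lambda>z. snd (snd z))"
    by (rule continuous_map_compose[OF continuous_map_snd continuous_map_snd, unfolded o_def])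
  have proj_p: "continuous_map ?X (prod_topology N1 ?J) (\<lambda>z. (fst z, snd (snd z)))"
    by (intro continuous_map_pairedI continuous_map_fst proj_t)
  have "continuous_map ?X (prod_topology euclidean (prod_topology euclidean euclidean))
      (\<lambda>z. (F1 (fst z) (snd (snd z)), F2 (fst (snd z)) (snd (snd z)), snd (snd z)))"
    using continuous_map_compose[OF proj_p cont1] continuous_map_compose[OF continuous_map_snd cont2]
      continuous_map_into_fulltopology[OF proj_t]
    by (intro continuous_map_pairedI) (simp_all add: o_def case_prod_unfold)
  then have cont_pair: "continuous_map ?X euclidean
      (\<lambda>z. (F1 (fst z) (snd (snd z)), F2 (fst (snd z)) (snd (snd z)), snd (snd z)))"
    by simp
  let ?g = "\<lambda>(x :: 'a \<times> real, y, t :: real). exp (2 * t) * (- minkowski x y - 1) + \<epsilon> * t"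
  have "continuous_map euclidean euclidean ?g"
    unfolding continuous_map_iff_continuous2 case_prod_unfold minkowski_def
    by (intro continuous_intros)
  from continuous_map_compose[OF cont_pair this]
  have cont_h: "continuous_map ?X euclidean (\<lambda>z. h (fst z) (fst (snd z)) (snd (snd z)))"
    by (simp add: o_def h_def)

  \<comment> \<open>Compactness of the sublevel set of \<open>h\<close>\<close>
  obtain R1 where R1: "snd (F1 p t) \<le> R1" if "p \<in> topspace N1" "t \<in> {0..t1}" for p t
  proof -
    have "compactin (prod_topology N1 ?J) (topspace N1 \<times> {0..t1})"
      unfolding compactin_Times using compact1 by (simp add: compact_space_def)
    from image_compactin[OF this cont1]
    have "bounded (snd ` (\<lambda>(p, t). F1 p t) ` (topspace N1 \<times> {0..t1}))"
      by (intro bounded_snd compact_imp_bounded) simp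
    then obtain R where "\<forall>x\<in>snd ` (\<lambda>(p, t). F1 p t) ` (topspace N1 \<times> {0..t1}). norm x \<le> R"
      unfolding bounded_iff by blast
    then have "snd (F1 p t) \<le> R" if "p \<in> topspace N1" "t \<in> {0..t1}" for p t
      using that by force
    then show thesis
      by (rule that)
  qed
  \<comment> \<open>Where \<open>h\<close> is at most \<open>c\<close>, the form
    \<open>- minkowski\<close> is at most \<open>c + 1\<close>; with the height bound
    \<open>R1\<close> for the first flow, \<open>snd_le_minkowski\<close> gives this bound for the
    second. Properness makes the preimage \<open>L\<close> compact.\<close>
  define B where "B = {q :: 'a \<times> real. q \<in> hyperbolic_space \<and> snd q \<le> 2 * R1 * (c + 1)}"
  define L where "L = {z \<in> topspace (prod_topology N2 ?J). (\<lambda>(q, t). F2 q t) z \<in> B}"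
  have "compactin (prod_topology N2 ?J) L"
    unfolding L_def
  proof (rule compactin_proper_map_preimage)
    show "proper_map (prod_topology N2 ?J) (top_of_set hyperbolic_space) (\<lambda>(q, t). F2 q t)"
      using proper2 t1 unfolding proper_flow_def by blast
    show "compactin (top_of_set hyperbolic_space) B"
      unfolding compactin_subtopology B_def compactin_euclidean_iff
      using compact_hyperbolic_space_bounded_height by blast
  qed
  then have "compactin ?X (topspace N1 \<times> L)"
    unfolding compactin_Times using compact1 by (simp add: compact_space_def)
  moreover have "closedin ?X {z \<in> topspace ?X. h (fst z) (fst (snd z)) (snd (snd z)) \<in> {..c}}"
    by (rule closedin_continuous_map_preimage[OF cont_h]) simp
  ultimately have "compactin ?X ((topspace N1 \<times> L) \<inter>
      {z \<in> topspace ?X. h (fst z) (fst (snd z)) (snd (snd z)) \<in> {..c}})" (is "compactin _ ?K")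
    by (rule compact_Int_closedin)
  from image_compactin[OF this continuous_map_into_fulltopology[OF proj_t]]
  have "compact ((\<lambda>z. snd (snd z)) ` ?K)"
    by simp
  have K: "(p, q, t) \<in> ?K" if "p \<in> topspace N1" "q \<in> topspace N2" "t \<in> {0..t1}" "h p q t \<le> c" for p q t
  proof -
    have tT: "t \<in> time_interval T"
      using that J by blast
    note hyp = mean_curvature_flow_in_hyperbolic_space[OF mcf1 that(1) tT]
      mean_curvature_flow_in_hyperbolic_space[OF mcf2 that(2) tT]
    have "?u p q t \<le> exp (2 * t) * ?u p q t"
      using mult_right_mono[of 1 "exp (2 * t)" "?u p q t"] u_nonneg[OF that(1,2) tT] that(3) by simp
    also have "\<dots> \<le> c"
      using that \<open>\<epsilon> > 0\<close> by (simp add: h_def) (smt (verit) mult_nonneg_nonneg)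
    finally have W: "- minkowski (F1 p t) (F2 q t) \<le> c + 1"
      by simp
    have pos: "0 < snd (F1 p t)"
      using hyp(1) by (simp add: hyperbolic_space_def)
    have "snd (F2 q t) \<le> 2 * snd (F1 p t) * (- minkowski (F1 p t) (F2 q t))"
      by (rule snd_le_minkowski[OF hyp])
    also have "\<dots> \<le> 2 * snd (F1 p t) * (c + 1)"
      using W pos by (intro mult_left_mono) auto
    also have "\<dots> \<le> 2 * R1 * (c + 1)"
      using R1[OF that(1,3)] c(4) by (intro mult_right_mono) auto
    finally show ?thesis
      using that hyp by (simp add: L_def B_def)
  qed
  have "h p1 q1 t1 \<le> c"
    using c(1) by (simp add: h_def a_def)
  then have "(p1, q1, t1) \<in> ?K"
    using t1_nonneg by (intro K p1 q1) auto
  then have "(\<lambda>z. snd (snd z)) ` ?K \<noteq> {}"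
    by blast
  \<comment> \<open>The least time in the compact projection of the sublevel set is the first time
    at which some pair of points reaches the level \<open>c\<close>.\<close>
  from compact_attains_inf[OF \<open>compact ((\<lambda>z. snd (snd z)) ` ?K)\<close> this]
  obtain z where z: "z \<in> ?K" and z_min: "\<And>z'. z' \<in> ?K \<Longrightarrow> snd (snd z) \<le> snd (snd z')"
    by auto
  obtain p q t where z_eq: "z = (p, q, t)"
    by (cases z)
  have pq: "p \<in> topspace N1" "q \<in> topspace N2" and t: "0 \<le> t" "t \<le> t1" and h_le: "h p q t \<le> c"
    using z by (auto simp: z_eq)
  have first: "c < h p' q' s" if "p' \<in> topspace N1" "q' \<in> topspace N2" "0 \<le> s" "s < t" for p' q' s
    using K[of p' q' s] z_min[of "(p', q', s)"] that t by (force simp: z_eq)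
  have tT: "t \<in> time_interval T"
    using J t by auto
  have "t \<noteq> 0"
    using initial[OF pq] h_le c(3) by (auto simp: h_def)
  with t have "0 < t" by simp
  \<comment> \<open>Before time \<open>t\<close> all values exceed \<open>c\<close>; letting the
    time increase to \<open>t\<close> along fixed trajectories gives the weak inequality at
    \<open>t\<close>. Hence \<open>(p, q)\<close> is a global spatial minimum.\<close>
  have h_ge: "c \<le> h p' q' t" if p': "p' \<in> topspace N1" and q': "q' \<in> topspace N2" for p' q'
  proof (rule continuous_ge_on_closure[where S = "{0..<t}" and f = "h p' q'" and x = t])
    have "{0..t} \<subseteq> time_interval T"
      using J t by auto
    then have "continuous_on {0..t} (F1 p')" "continuous_on {0..t} (F2 q')"
      using continuous_on_mean_curvature_flow[OF mcf1 man1 p'] continuous_on_mean_curvature_flow[OF mcf2 man2 q']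
      by (auto intro: continuous_on_subset)
    then have "continuous_on {0..t} (h p' q')"
      unfolding h_def by (intro continuous_intros minkowski.continuous_on)
    then show "continuous_on (closure {0..<t}) (h p' q')"
      using \<open>0 < t\<close> by simp
    show "t \<in> closure {0..<t}"
      using \<open>0 < t\<close> by simp
    show "c \<le> h p' q' s" if "s \<in> {0..<t}" for s
      using first[OF p' q', of s] that by simp
  qed
  have h_eq: "h p q t = c"
    using h_le h_ge[OF pq] by simp
  have "minkowski (F1 p' t) (F2 q' t) \<le> minkowski (F1 p t) (F2 q t)"
    if "p' \<in> topspace N1" "q' \<in> topspace N2" for p' q'
    using h_ge[OF that] unfolding h_eq[symmetric] by (simp add: h_def)
  moreover have "minkowski (F1 p t) (F2 q t) < - 1"
  proof -
    have "\<epsilon> * t \<le> \<epsilon> * t1"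
      using t \<open>\<epsilon> > 0\<close> by simp
    then have "0 < exp (2 * t) * ?u p q t"
      using h_eq c(2) by (simp add: h_def)
    then show ?thesis
      by (simp add: zero_less_mult_iff)
  qed
  ultimately obtain D where
    D: "((\<lambda>s. minkowski (F1 p s) (F2 q s)) has_real_derivative D) (at t within time_interval T)"
      "D \<le> - 2 * (minkowski (F1 p t) (F2 q t) + 1)"
    by (rule minkowski_derivative_at_spatial_minimum[OF dim man1 mcf1 man2 mcf2 pq tT])
  \<comment> \<open>The weight \<open>exp (2 * t)\<close> compensates the bound on \<open>D\<close>
    exactly, and the drift makes the derivative strictly positive. So \<open>h p q\<close> lies
    below \<open>c\<close> just before \<open>t\<close>, against the choice of \<open>t\<close> as
    first time.\<close>
  have "(h p q has_real_derivative exp (2 * t) * (2 * ?u p q t - D) + \<epsilon>) (at t within time_interval T)"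
    unfolding h_def by (rule derivative_eq_intros D(1) refl)+ (simp add: algebra_simps)
  moreover have "0 < exp (2 * t) * (2 * ?u p q t - D) + \<epsilon>"
    using D(2) \<open>\<epsilon> > 0\<close> by (intro add_nonneg_pos mult_nonneg_nonneg) auto
  ultimately obtain \<delta> where "\<delta> > 0"
    and \<delta>: "\<And>s. 0 < s \<Longrightarrow> t - s \<in> time_interval T \<Longrightarrow> s < \<delta> \<Longrightarrow> h p q (t - s) < h p q t"
    using has_real_derivative_pos_inc_left by blast
  define s where "s = min \<delta> t / 2"
  have s: "0 < s" "s < \<delta>" "s < t"
    using \<open>\<delta> > 0\<close> \<open>0 < t\<close> by (auto simp: s_def)
  have "t - s \<in> time_interval T"
    using J s t by auto
  from \<delta>[OF s(1) this s(2)] have "h p q (t - s) < c"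
    by (simp add: h_eq)
  with first[OF pq, of "t - s"] s show False
    by simp
qed

section \<open>The distance estimate\<close>

lemma cosh_minus_1_eq: "cosh x - 1 = 2 * (sinh (x / 2))\<^sup>2" for x :: real
  using cosh_double[of "x / 2"] by (simp add: cosh_square_eq)

text \<open>Convexity of \<open>sinh\<close> on the nonnegative axis: the difference of the two
  sides vanishes at \<open>0\<close> and is nondecreasing since \<open>cosh\<close> is monotone
  there. It turns the \<open>sinh\<close> estimate into the linear one.\<close>

lemma mult_sinh_le_sinh_mult:
  fixes x c :: real
  assumes "0 \<le> x" "1 \<le> c"
  shows "c * sinh x \<le> sinh (c * x)"
proof -
  have "sinh (c * 0) - c * sinh 0 \<le> sinh (c * x) - c * sinh x"
  proof (rule DERIV_nonneg_imp_nondecreasing[OF assms(1)])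
    fix y :: real assume y: "0 \<le> y"
    have "((\<lambda>y. sinh (c * y) - c * sinh y) has_real_derivative c * (cosh (c * y) - cosh y)) (at y)"
      by (auto intro!: derivative_eq_intros simp: algebra_simps)
    moreover have "cosh y \<le> cosh (c * y)"
      using y assms by (subst cosh_real_nonneg_le_iff) (auto simp: mult_le_cancel_right1)
    ultimately show "\<exists>d. ((\<lambda>y. sinh (c * y) - c * sinh y) has_real_derivative d) (at y) \<and> 0 \<le> d"
      using assms(2) by (intro exI conjI) auto
  qed
  then show ?thesis by simp
qed


theorem theorem3p1:
  fixes N1 :: "'p topology" and N2 :: "'q topology"
    and \<A>1 :: "('p set \<times> ('p \<Rightarrow> 'm::euclidean_space)) set"
    and \<A>2 :: "('q set \<times> ('q \<Rightarrow> 'm)) set"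
    and F1 :: "'p \<Rightarrow> real \<Rightarrow> 'a::euclidean_space \<times> real"
    and F2 :: "'q \<Rightarrow> real \<Rightarrow> 'a \<times> real"
    and T :: ereal
  defines "\<Sigma>1 \<equiv> \<lambda>t. (\<lambda>p. F1 p t) ` topspace N1"
    and "\<Sigma>2 \<equiv> \<lambda>t. (\<lambda>q. F2 q t) ` topspace N2"
  defines "d \<equiv> \<lambda>t. hyperbolic_setdist (\<Sigma>1 t) (\<Sigma>2 t)"
  assumes dim: "DIM('a) = DIM('m) + 1"
    and manifold1: "smooth_manifold N1 \<A>1" "topspace N1 \<noteq> {}"
    and manifold2: "smooth_manifold N2 \<A>2" "topspace N2 \<noteq> {}"
    and T_pos: "0 < T"
    and mcf1: "mean_curvature_flow N1 \<A>1 T F1"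
    and mcf2: "mean_curvature_flow N2 \<A>2 T F2"
    and compact1: "compact (\<Sigma>1 0)"
    and proper2: "proper_flow N2 T F2"
  shows "\<forall>t\<in>time_interval T.
           exp t * sinh (d t / 2) \<ge> sinh (d 0 / 2) \<and> exp t * d t \<ge> d 0"
proof
  fix t assume t: "t \<in> time_interval T"
  then have "0 \<le> t" by (simp add: time_interval_def)
  have zero: "0 \<in> time_interval T"
    using T_pos by (simp add: time_interval_def zero_ereal_def)
  let ?dist = "\<lambda>p q s. hyperbolic_dist (F1 p s) (F2 q s)"
  have W: "- minkowski (F1 p s) (F2 q s) \<ge> 1"
    if "p \<in> topspace N1" "q \<in> topspace N2" "s \<in> time_interval T" for p q s
    using minkowski_le_neg_1[OF mean_curvature_flow_in_hyperbolic_space[OF mcf1 that(1,3)]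
        mean_curvature_flow_in_hyperbolic_space[OF mcf2 that(2,3)]] by simp
  have dist_nonneg: "0 \<le> ?dist p q s"
    if "p \<in> topspace N1" "q \<in> topspace N2" "s \<in> time_interval T" for p q s
    using W[OF that] unfolding hyperbolic_dist_def by (rule arcosh_nonneg_real)
  have cosh_dist: "cosh (?dist p q s) = - minkowski (F1 p s) (F2 q s)"
    if "p \<in> topspace N1" "q \<in> topspace N2" "s \<in> time_interval T" for p q s
    using W[OF that] unfolding hyperbolic_dist_def by (rule cosh_arcosh_real)
  have d_eq: "d s = (INF z\<in>topspace N1 \<times> topspace N2. ?dist (fst z) (snd z) s)" for s
  proof -
    have "(\<lambda>(p, q). hyperbolic_dist p q) ` (\<Sigma>1 s \<times> \<Sigma>2 s)
        = (\<lambda>z. ?dist (fst z) (snd z) s) ` (topspace N1 \<times> topspace N2)"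
      unfolding \<Sigma>1_def \<Sigma>2_def by force
    then show ?thesis
      by (simp add: d_def hyperbolic_setdist_def)
  qed
  have d_greatest: "x \<le> d s"
    if "\<And>p q. p \<in> topspace N1 \<Longrightarrow> q \<in> topspace N2 \<Longrightarrow> x \<le> ?dist p q s" for x s
    unfolding d_eq using that manifold1(2) manifold2(2) by (intro cINF_greatest) auto
  have d_nonneg: "0 \<le> d s" if "s \<in> time_interval T" for s
    using dist_nonneg that by (intro d_greatest)
  have d_le: "d s \<le> ?dist p q s"
    if "p \<in> topspace N1" "q \<in> topspace N2" "s \<in> time_interval T" for p q s
  proof -
    have "bdd_below ((\<lambda>z. ?dist (fst z) (snd z) s) ` (topspace N1 \<times> topspace N2))"
      using dist_nonneg that(3) by (intro bdd_belowI2[where m = 0]) auto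
    from cINF_lower[OF this, of "(p, q)"] show ?thesis
      using that by (simp add: d_eq)
  qed
  have N1: "compact_space N1"
    using compact_space_mean_curvature_flow[OF mcf1] compact1 by (simp add: \<Sigma>1_def)
  \<comment> \<open>The initial bound \<open>u\<close> of the minimum principle is taken to be
    \<open>cosh (d 0) - 1\<close>.\<close>
  have initial: "cosh (d 0) - 1 \<le> - minkowski (F1 p 0) (F2 q 0) - 1"
    if "p \<in> topspace N1" "q \<in> topspace N2" for p q
    using d_le[OF that zero] d_nonneg[OF zero] dist_nonneg[OF that zero]
    by (simp add: cosh_real_nonneg_le_iff flip: cosh_dist[OF that zero])
  have pointwise: "sinh (d 0 / 2) \<le> exp t * sinh (?dist p q t / 2)"
    if "p \<in> topspace N1" "q \<in> topspace N2" for p q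
  proof (rule power2_le_imp_le)
    have "cosh (d 0) - 1 \<le> exp (2 * t) * (cosh (?dist p q t) - 1)"
      using minkowski_exponential_growth[OF dim manifold1(1) mcf1 manifold2(1) mcf2 N1 proper2 initial that t]
      by (simp add: cosh_dist[OF that t])
    then show "(sinh (d 0 / 2))\<^sup>2 \<le> (exp t * sinh (?dist p q t / 2))\<^sup>2"
      by (simp add: cosh_minus_1_eq power_mult_distrib exp_double)
    show "0 \<le> exp t * sinh (?dist p q t / 2)"
      using dist_nonneg[OF that t] by simp
  qed
  \<comment> \<open>Solving the pointwise estimate for the distance gives a lower bound independent
    of \<open>p\<close> and \<open>q\<close>, which passes to the infimum; monotonicity of
    \<open>sinh\<close> then restores the original form.\<close>
  have "2 * arsinh (sinh (d 0 / 2) / exp t) \<le> d t"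
  proof (rule d_greatest)
    fix p q assume "p \<in> topspace N1" "q \<in> topspace N2"
    from pointwise[OF this] have "sinh (d 0 / 2) / exp t \<le> sinh (?dist p q t / 2)"
      by (simp add: pos_divide_le_eq mult.commute)
    then have "sinh (arsinh (sinh (d 0 / 2) / exp t)) \<le> sinh (?dist p q t / 2)"
      by simp
    then have "arsinh (sinh (d 0 / 2) / exp t) \<le> ?dist p q t / 2"
      by (simp only: sinh_real_le_iff)
    then show "2 * arsinh (sinh (d 0 / 2) / exp t) \<le> ?dist p q t"
      by simp
  qed
  then have "sinh (arsinh (sinh (d 0 / 2) / exp t)) \<le> sinh (d t / 2)"
    by (simp del: sinh_arsinh_real)
  then have main: "sinh (d 0 / 2) \<le> exp t * sinh (d t / 2)"
    by (simp add: pos_divide_le_eq mult.commute)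
  also have "\<dots> \<le> sinh (exp t * (d t / 2))"
    using d_nonneg[OF t] \<open>0 \<le> t\<close> by (intro mult_sinh_le_sinh_mult) auto
  finally have "d 0 \<le> exp t * d t"
    by simp
  with main show "exp t * sinh (d t / 2) \<ge> sinh (d 0 / 2) \<and> exp t * d t \<ge> d 0"
    by simp
qed

end
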